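(* Let $n \geq 3$ be an integer and let $P$ be a bidiophantine $n$-gon such that some side or some diagonal of $P$ has length $3$. Then $n \in \{3, 4\}$.
   Context: Polygons lie in the Euclidean plane $\mathbb{R}^2$ and may be convex or concave. Natural numbers are the positive integers. A polygon is called Diophantine if the distance between every two of its vertices is a natural number. A Diophantine polygon is called bidiophantine if both coordinates of each of its vertices are integers. A diagonal is a segment joining two non-adjacent vertices.
   Formalization: Polygons are taken to be simple with no three vertices collinear; without the latter the claim fails, e.g. for the concave bidiophantine pentagon (0,0), (3,0), (0,4), (-3,0), (0,-4), which has a side of length 3. *)

theory Defs
  imports "HOL-Analysis.Analysis"
begin

text \<open>A polygon is given by the cyclic list of its vertices.\<close>

definition poly_next :: "'a list \<Rightarrow> nat \<Rightarrow> nat" where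
  "poly_next P i = Suc i mod length P"

definition poly_edge :: "(real^2) list \<Rightarrow> nat \<Rightarrow> (real^2) set" where
  "poly_edge P i = closed_segment (P ! i) (P ! poly_next P i)"

definition simple_closed :: "(real^2) list \<Rightarrow> bool" where
  "simple_closed P \<longleftrightarrow>
     (\<forall>i < length P. \<forall>j < length P. i \<noteq> j \<longrightarrow>
        poly_edge P i \<inter> poly_edge P j =
          {P ! i, P ! poly_next P i} \<inter> {P ! j, P ! poly_next P j})"

definition no_three_collinear :: "(real^2) set \<Rightarrow> bool" where
  "no_three_collinear S \<longleftrightarrow>
     (\<forall>x\<in>S. \<forall>y\<in>S. \<forall>z\<in>S. x \<noteq> y \<and> x \<noteq> z \<and> y \<noteq> z \<longrightarrow> \<not> collinear {x, y, z})"

text \<open>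
  Polygons are simple, possibly concave, and nondegenerate in the sense that no three
  vertices are collinear. For convex polygons this only excludes straight angles. For
  concave ones it cannot be relaxed to consecutive vertices: the simple pentagon
  (0,0), (3,0), (0,4), (-3,0), (0,-4) has no straight angle and has integer coordinates,
  and its vertices are at the mutual distances 3, 4, 5, 6, 8.
\<close>

definition polygon :: "(real^2) list \<Rightarrow> bool" where
  "polygon P \<longleftrightarrow>
     length P \<ge> 3 \<and> distinct P \<and> simple_closed P \<and> no_three_collinear (set P)"

definition is_side :: "(real^2) list \<Rightarrow> real^2 \<Rightarrow> real^2 \<Rightarrow> bool" where
  "is_side P u v \<longleftrightarrow> (\<exists>i < length P. u = P ! i \<and> v = P ! poly_next P i)"

definition is_diagonal :: "(real^2) list \<Rightarrow> real^2 \<Rightarrow> real^2 \<Rightarrow> bool" where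
  "is_diagonal P u v \<longleftrightarrow>
     u \<in> set P \<and> v \<in> set P \<and> u \<noteq> v \<and> \<not> is_side P u v \<and> \<not> is_side P v u"

definition diophantine :: "(real^2) list \<Rightarrow> bool" where
  "diophantine P \<longleftrightarrow> polygon P \<and>
     (\<forall>u \<in> set P. \<forall>v \<in> set P. u \<noteq> v \<longrightarrow> (\<exists>k::nat. k \<ge> 1 \<and> dist u v = real k))"

definition bidiophantine :: "(real^2) list \<Rightarrow> bool" where
  "bidiophantine P \<longleftrightarrow> diophantine P \<and> (\<forall>u \<in> set P. u $ 1 \<in> \<int> \<and> u $ 2 \<in> \<int>)"

end

(* Place the side or diagonal of length 3 at (0,0), (3,0).  By the strict triangle inequality and
   parity, the distances of every other vertex to these two points differ by exactly 1, so that
   vertex lies on the hyperbola y^2 = 8(x-1)(x-2).  Let two points of the hyperbola differ by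
   p(a,b) with a, b coprime and have integral distance.  Then N = 8a^2 - b^2 divides 64, while
   9a^2 - N = a^2 + b^2 is a square.  Parity leaves N = -1, 4, 8, -8; as 9a^2 is itself a square,
   each of these (N = -8 by reduction modulo 3) forces a = 0 or b = 0 or is impossible.  Hence the
   two points are mirror images in the x-axis or in the line x = 3/2, which cannot hold for all
   three pairs out of three points. *)

theory Submission
  imports Defs
begin

section \<open>Squares in residue classes, divisors of 64, and squares near 9a^2\<close>

lemma int_square_mod_3: "(s::int)\<^sup>2 mod 3 \<noteq> 2"
proof -
  have "s mod 3 = 0 \<or> s mod 3 = 1 \<or> s mod 3 = 2" by presburger
  then have "(s mod 3)\<^sup>2 mod 3 \<noteq> 2" by auto
  then show ?thesis by (simp add: power_mod)
qed

lemma odd_square_mod_8: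
  fixes a :: int
  assumes "odd a"
  shows "a\<^sup>2 mod 8 = 1"
proof -
  have "a mod 8 = 1 \<or> a mod 8 = 3 \<or> a mod 8 = 5 \<or> a mod 8 = 7" using assms by presburger
  then have "(a mod 8)\<^sup>2 mod 8 = 1" by auto
  then show ?thesis by (simp add: power_mod)
qed

text \<open>The candidates are plus or minus a power of 2 up to 64. Among them residue 7 modulo 8
  selects only -1, residue 4 modulo 32 only 4, and residue 8 modulo 16 only 8 and -8.\<close>

lemma dvd_64_cases:
  fixes N :: int
  assumes "N dvd 64" and "N mod 8 = 7 \<or> N mod 32 = 4 \<or> N mod 16 = 8"
  shows "N \<in> {-1, 4, 8, -8}"
proof -
  have "nat \<bar>N\<bar> dvd 2 ^ 6" using assms by (simp add: nat_abs_dvd_iff)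
  then obtain k where k: "k \<le> 6" "nat \<bar>N\<bar> = 2 ^ k"
    using divides_primepow_nat[OF two_is_prime_nat] by blast
  have "k \<in> {0, 1, 2, 3, 4, 5, 6}" using k(1) by auto
  moreover have "\<bar>N\<bar> = 2 ^ k" using k(2) by (metis abs_ge_zero int_nat_eq of_nat_numeral of_nat_power)
  ultimately have "\<bar>N\<bar> \<in> {1, 2, 4, 8, 16, 32, 64}" by auto
  then have "N \<in> {1, 2, 4, 8, 16, 32, 64, -1, -2, -4, -8, -16, -32, -64}"
    by (auto simp: abs_if split: if_splits)
  then show ?thesis using assms(2) by auto
qed

text \<open>The residue depends on the power of 2 in b: 7 modulo 8 if b is odd, 4 modulo 32 if b is
  twice an odd number, 8 modulo 16 if 4 divides b. In the even cases a is odd by coprimality, so a^2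
  is 1 modulo 8.\<close>

lemma coprime_form_dvd_64:
  fixes a b :: int
  assumes cop: "coprime a b" and dvd: "8 * a\<^sup>2 - b\<^sup>2 dvd 64"
  shows "8 * a\<^sup>2 - b\<^sup>2 \<in> {-1, 4, 8, -8}"
proof (rule dvd_64_cases[OF dvd], cases "odd b")
  case True
  then have "(8 * a\<^sup>2 - b\<^sup>2) mod 8 = 7" using odd_square_mod_8[of b] by presburger
  then show "(8 * a\<^sup>2 - b\<^sup>2) mod 8 = 7 \<or> (8 * a\<^sup>2 - b\<^sup>2) mod 32 = 4 \<or> (8 * a\<^sup>2 - b\<^sup>2) mod 16 = 8"
    by blast
next
  case False
  then obtain c where c: "b = 2 * c" by blast
  have "odd a" using cop False coprime_common_divisor[of a b 2] by auto
  then obtain l where l: "a\<^sup>2 = 8 * l + 1" using odd_square_mod_8[of a] by (metis mult_div_mod_eq)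
  show "(8 * a\<^sup>2 - b\<^sup>2) mod 8 = 7 \<or> (8 * a\<^sup>2 - b\<^sup>2) mod 32 = 4 \<or> (8 * a\<^sup>2 - b\<^sup>2) mod 16 = 8"
  proof (cases "odd c")
    case True
    have "b\<^sup>2 = 4 * c\<^sup>2" by (simp add: c power_mult_distrib)
    moreover obtain k where "c\<^sup>2 = 8 * k + 1" using odd_square_mod_8[OF True] by (metis mult_div_mod_eq)
    ultimately have "8 * a\<^sup>2 - b\<^sup>2 = 4 + 32 * (2 * l - k)" using l by simp
    then have "(8 * a\<^sup>2 - b\<^sup>2) mod 32 = 4" by (simp only: mod_mult_self2) simp
    then show ?thesis by blast
  next
    case False
    then obtain d where "c = 2 * d" by blast
    then have "b\<^sup>2 = 16 * d\<^sup>2" by (simp add: c power_mult_distrib)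
    then have "8 * a\<^sup>2 - b\<^sup>2 = 8 + 16 * (4 * l - d\<^sup>2)" using l by simp
    then have "(8 * a\<^sup>2 - b\<^sup>2) mod 16 = 8" by (simp only: mod_mult_self2) simp
    then show ?thesis by blast
  qed
qed

text \<open>A square other than 9a^2 lies at or beyond a neighbouring square (3|a| + 1)^2 or (3|a| -
  1)^2. These differ from 9a^2 by 6|a| + 1 and 6|a| - 1, so a small difference bounds |a|.\<close>

lemma near_square:
  fixes a s :: int
  shows "s\<^sup>2 = 9 * a\<^sup>2 + 1 \<Longrightarrow> a = 0" and "s\<^sup>2 \<noteq> 9 * a\<^sup>2 - 4" and "s\<^sup>2 = 9 * a\<^sup>2 - 8 \<Longrightarrow> a\<^sup>2 = 1"
proof -
  define t where "t = \<bar>s\<bar>"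
  define c where "c = \<bar>a\<bar>"
  have t: "s\<^sup>2 = t\<^sup>2" "t \<ge> 0" and c: "a\<^sup>2 = c\<^sup>2" "c \<ge> 0" by (auto simp: t_def c_def)
  have lt: "(3 * c)\<^sup>2 < t\<^sup>2 \<Longrightarrow> 3 * c + 1 \<le> t" using t c power_less_imp_less_base[of "3 * c" 2 t] by auto
  have gt: "t\<^sup>2 < (3 * c)\<^sup>2 \<Longrightarrow> t \<le> 3 * c - 1" using t c power_less_imp_less_base[of t 2 "3 * c"] by auto
  {
    assume e: "s\<^sup>2 = 9 * a\<^sup>2 + 1"
    then have "3 * c + 1 \<le> t" using lt t c by (simp add: power_mult_distrib)
    then have "(3 * c + 1)\<^sup>2 \<le> t\<^sup>2" using c by (intro power_mono) auto
    then have "c = 0" using e t c by (simp add: power2_eq_square algebra_simps)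
    then show "a = 0" by (simp add: c_def)
  }
  {
    show "s\<^sup>2 \<noteq> 9 * a\<^sup>2 - 4"
    proof
      assume e: "s\<^sup>2 = 9 * a\<^sup>2 - 4"
      then have "t \<le> 3 * c - 1" using gt t c by (simp add: power_mult_distrib)
      then have "t\<^sup>2 \<le> (3 * c - 1)\<^sup>2" using t by (intro power_mono) auto
      then have "c \<le> 0" using e t c by (simp add: power2_eq_square algebra_simps)
      then have "c = 0" using c by simp
      then show False using e t c by (smt (verit) zero_le_power2 zero_power2)
    qed
  }
  {
    assume e: "s\<^sup>2 = 9 * a\<^sup>2 - 8"
    then have "t \<le> 3 * c - 1" using gt t c by (simp add: power_mult_distrib)
    then have "t\<^sup>2 \<le> (3 * c - 1)\<^sup>2" using t by (intro power_mono) auto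
    then have "c \<le> 1" using e t c by (simp add: power2_eq_square algebra_simps)
    moreover have "c \<noteq> 0" using e t c by (smt (verit) zero_le_power2 zero_power2)
    ultimately have "c = 1" using c by simp
    then show "a\<^sup>2 = 1" using c by simp
  }
qed

section \<open>Lattice points at integral distances on the hyperbola\<close>

lemma hyperbola_pair:
  fixes x1 y1 x2 y2 D :: int
  assumes h1: "y1\<^sup>2 = 8 * (x1 - 1) * (x1 - 2)" and h2: "y2\<^sup>2 = 8 * (x2 - 1) * (x2 - 2)"
    and D: "(x1 - x2)\<^sup>2 + (y1 - y2)\<^sup>2 = D\<^sup>2"
  shows "x1 = x2 \<or> y1 = y2"
proof (rule ccontr)
  assume "\<not> (x1 = x2 \<or> y1 = y2)"
  then have ne: "x1 - x2 \<noteq> 0" "y1 - y2 \<noteq> 0" by auto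
  define p where "p = gcd (x1 - x2) (y1 - y2)"
  have p0: "p \<noteq> 0" using ne by (simp add: p_def)
  obtain a b where a: "x1 - x2 = p * a" and b: "y1 - y2 = p * b" and cop: "coprime a b"
    unfolding p_def using ne
    by (metis div_gcd_coprime dvd_mult_div_cancel gcd_dvd1 gcd_dvd2)
  have ab: "a \<noteq> 0" "b \<noteq> 0" using ne a b by auto
  have "p\<^sup>2 * (a\<^sup>2 + b\<^sup>2) = D\<^sup>2" using D a b by (simp add: power_mult_distrib distrib_left)
  then have "p\<^sup>2 dvd D\<^sup>2" by (metis dvd_triv_left)
  \<comment> \<open>Divisibility of squares passes to the bases, so the reduced vector (a, b) also
    has integral length.\<close>
  then obtain s where "D = p * s" by auto
  then have s: "s\<^sup>2 = a\<^sup>2 + b\<^sup>2"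
    using \<open>p\<^sup>2 * (a\<^sup>2 + b\<^sup>2) = D\<^sup>2\<close> p0 by (simp add: power_mult_distrib)
  \<comment> \<open>(S/2, T/2) is the midpoint of the chord, seen from the centre (3/2, 0) of the
    hyperbola.\<close>
  define S where "S = x1 + x2 - 3"
  define T where "T = y1 + y2"
  \<comment> \<open>The difference of the two hyperbola equations, factored on both sides.\<close>
  have "(y1 - y2) * T = 8 * (x1 - x2) * S"
    unfolding S_def T_def using h1 h2 by (simp add: power2_eq_square algebra_simps)
  then have "p * (b * T) = p * (8 * a * S)" using a b by (simp add: mult_ac)
  then have bT: "b * T = 8 * a * S" using p0 by simp
  then have "a dvd b * T" by simp
  then have "a dvd T" using cop coprime_dvd_mult_right_iff by blast
  then obtain r where r: "T = a * r" by blast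
  have br: "8 * S = b * r" using bT ab r by simp
  \<comment> \<open>Twice the first point is the sum plus the difference of the two points; doubling
    avoids halves.\<close>
  have X: "2 * x1 = S + p * a + 3" and Y: "2 * y1 = a * r + p * b"
    using a b r by (auto simp: S_def T_def)
  have "4 * y1\<^sup>2 = 8 * ((2 * x1 - 3)\<^sup>2 - 1)" using h1 by (simp add: power2_eq_square algebra_simps)
  then have "(2 * y1)\<^sup>2 = 8 * ((2 * x1 - 3)\<^sup>2 - 1)" by simp
  then have "(a * r + p * b)\<^sup>2 = 8 * ((S + p * a)\<^sup>2 - 1)" using X Y by simp
  then have "8 * (a * r + p * b)\<^sup>2 = (8 * S + 8 * p * a)\<^sup>2 - 64"
    by (simp add: power2_eq_square algebra_simps)
  \<comment> \<open>After substituting br for 8S the mixed terms 16abpr cancel, and what remains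
    factors.\<close>
  then have "(8 * a\<^sup>2 - b\<^sup>2) * (8 * p\<^sup>2 - r\<^sup>2) = 64"
    unfolding br by (simp add: power2_eq_square algebra_simps)
  then have "8 * a\<^sup>2 - b\<^sup>2 dvd 64" by (metis dvd_triv_left)
  from coprime_form_dvd_64[OF cop this]
  consider "s\<^sup>2 = 9 * a\<^sup>2 + 1" | "s\<^sup>2 = 9 * a\<^sup>2 - 4" | "s\<^sup>2 = 9 * a\<^sup>2 - 8" | "s\<^sup>2 = 9 * a\<^sup>2 + 8"
    using s by fastforce
  then show False
  proof cases
    case 1 then show ?thesis using near_square(1) ab by blast
  next
    case 2 then show ?thesis using near_square(2) by blast
  next
    case 3
    then have "a\<^sup>2 = 1" by (rule near_square(3))
    \<comment> \<open>Here s^2 = 1 = a^2, so b = 0.\<close>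
    then show ?thesis using 3 s ab by simp
  next
    case 4
    then have "s\<^sup>2 mod 3 = 2" by presburger
    then show ?thesis using int_square_mod_3 by blast
  qed
qed

text \<open>Here p and q are the distances to (0,0) and (3,0). Once p - q is 1 or -1, dividing p^2 -
  q^2 = 6x - 9 by it yields p + q, hence p up to sign as 3x - 4.\<close>

lemma on_hyperbola:
  fixes x y p q :: int
  assumes p: "x\<^sup>2 + y\<^sup>2 = p\<^sup>2" and q: "(x - 3)\<^sup>2 + y\<^sup>2 = q\<^sup>2" and "y \<noteq> 0" "p \<ge> 0" "q \<ge> 0"
  shows "y\<^sup>2 = 8 * (x - 1) * (x - 2)"
proof -
  have diff: "(p - q) * (p + q) = 6 * x - 9"
    using p q by (simp add: power2_eq_square algebra_simps)
  \<comment> \<open>Lagrange's identity for the vectors (x, y) and (x - 3, y), whose determinant is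
    3y; it makes Cauchy-Schwarz strict off the axis.\<close>
  have "(p * q)\<^sup>2 = (x * (x - 3) + y\<^sup>2)\<^sup>2 + 9 * y\<^sup>2"
    unfolding power_mult_distrib p[symmetric] q[symmetric] by algebra
  then have "(x * (x - 3) + y\<^sup>2)\<^sup>2 < (p * q)\<^sup>2" using \<open>y \<noteq> 0\<close> by simp
  then have "x * (x - 3) + y\<^sup>2 < p * q" using assms by (meson mult_nonneg_nonneg power2_less_imp_less)
  \<comment> \<open>The law of cosines for the side of length 3.\<close>
  moreover have "(p - q)\<^sup>2 = 9 + 2 * (x * (x - 3) + y\<^sup>2) - 2 * (p * q)"
    using p q by (simp add: power2_eq_square algebra_simps)
  ultimately have "(p - q)\<^sup>2 < 3\<^sup>2" by simp
  then have "\<bar>p - q\<bar> < 3" by (metis abs_le_square_iff abs_numeral linorder_not_less)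
  moreover have "odd (p - q)" using diff by (metis even_add even_diff even_mult_iff even_numeral odd_numeral)
  ultimately have "p - q = 1 \<or> p - q = -1" by presburger
  then have "2 * p = 6 * x - 8 \<or> 2 * p = 8 - 6 * x" using diff by auto
  then have "p = 3 * x - 4 \<or> p = 4 - 3 * x" by auto
  then have "p\<^sup>2 = (3 * x - 4)\<^sup>2" by (auto simp: power2_commute)
  then show ?thesis using p by (simp add: power2_eq_square algebra_simps)
qed

text \<open>Pigeonhole: two of the three pairs use the same reflection. They share a point, so their
  other points coincide.\<close>

lemma no_hyperbola_triple:
  fixes x1 y1 x2 y2 x3 y3 :: int
  assumes h: "y1\<^sup>2 = 8 * (x1 - 1) * (x1 - 2)" "y2\<^sup>2 = 8 * (x2 - 1) * (x2 - 2)"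
      "y3\<^sup>2 = 8 * (x3 - 1) * (x3 - 2)"
    and nz: "y1 \<noteq> 0" "y2 \<noteq> 0" "y3 \<noteq> 0"
    and ne: "(x1, y1) \<noteq> (x2, y2)" "(x1, y1) \<noteq> (x3, y3)" "(x2, y2) \<noteq> (x3, y3)"
    and d: "(x1 - x2)\<^sup>2 + (y1 - y2)\<^sup>2 = d12\<^sup>2" "(x1 - x3)\<^sup>2 + (y1 - y3)\<^sup>2 = d13\<^sup>2"
      "(x2 - x3)\<^sup>2 + (y2 - y3)\<^sup>2 = d23\<^sup>2"
  shows False
proof -
  have mirror: "x' = x \<and> y' = - y \<or> y' = y \<and> x' = 3 - x"
    if "y\<^sup>2 = 8 * (x - 1) * (x - 2)" "y'\<^sup>2 = 8 * (x' - 1) * (x' - 2)" "(x, y) \<noteq> (x', y')"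
      "(x - x')\<^sup>2 + (y - y')\<^sup>2 = e\<^sup>2" for x y x' y' e :: int
    using hyperbola_pair[OF that(1,2,4)]
  proof
    assume "x = x'"
    then have "y\<^sup>2 = y'\<^sup>2" using that(1,2) by simp
    then show ?thesis using that(3) \<open>x = x'\<close> by (auto simp: power2_eq_iff)
  next
    assume "y = y'"
    then have "(x - x') * (x + x' - 3) = 0" using that(1,2) by (simp add: algebra_simps)
    then show ?thesis using that(3) \<open>y = y'\<close> by auto
  qed
  have "2 * x1 \<noteq> 3" by presburger
  then show False
    using mirror[OF h(1,2) ne(1) d(1)] mirror[OF h(1,3) ne(2) d(2)] mirror[OF h(2,3) ne(3) d(3)] nz ne
    by auto
qed

section \<open>From vertices in the plane to integer coordinates\<close>

lemma int_square_sum_9: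
  fixes a b :: int
  assumes "a\<^sup>2 + b\<^sup>2 = 9"
  shows "\<bar>a\<bar> = 3 \<and> b = 0 \<or> a = 0 \<and> \<bar>b\<bar> = 3"
proof -
  have "a\<^sup>2 \<le> 9" "b\<^sup>2 \<le> 9"
    using assms zero_le_power2[of a] zero_le_power2[of b] by linarith+
  then have "\<bar>a\<bar> \<le> 3" "\<bar>b\<bar> \<le> 3" using abs_le_square_iff[of _ "3 :: int"] by simp_all
  then have "a \<in> {-3, -2, -1, 0, 1, 2, 3}" "b \<in> {-3, -2, -1, 0, 1, 2, 3}" by auto
  then show ?thesis using assms by auto
qed

lemma collinear_same_coordinate:
  fixes S :: "(real^2) set"
  assumes "\<And>u v. u \<in> S \<Longrightarrow> v \<in> S \<Longrightarrow> u $ i = v $ i"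
  shows "collinear S"
proof -
  obtain j :: 2 where j: "\<And>k. k = i \<or> k = j" by (metis (full_types) exhaust_2)
  have "u - v = (u $ j - v $ j) *\<^sub>R axis j 1" if "u \<in> S" "v \<in> S" for u v
    unfolding vec_eq_iff
  proof
    fix k
    show "(u - v) $ k = ((u $ j - v $ j) *\<^sub>R axis j 1) $ k"
      using j[of k] assms[OF that] by (auto simp: axis_def)
  qed
  then show ?thesis unfolding collinear_def by blast
qed

text \<open>A fifth point would leave three points besides \<open>A\<close> and \<open>B\<close>; in
  adapted coordinates all three lie on the hyperbola.\<close>

lemma integral_distance_3_card_le_4:
  fixes S :: "(real^2) set"
  assumes fin: "finite S" and col: "no_three_collinear S"
    and int_dist: "\<And>u v. u \<in> S \<Longrightarrow> v \<in> S \<Longrightarrow> dist u v \<in> \<int>"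
    and coord: "\<And>u i. u \<in> S \<Longrightarrow> u $ i \<in> \<int>"
    and AB: "A \<in> S" "B \<in> S" "dist A B = 3"
  shows "card S \<le> 4"
proof (rule ccontr)
  assume "\<not> card S \<le> 4"
  moreover have "A \<noteq> B" using AB by auto
  ultimately have "card (S - {A, B}) \<ge> 3"
    using AB fin by (simp add: card_Diff_subset)
  then obtain T where T: "T \<subseteq> S - {A, B}" "card T = 3"
    by (metis obtain_subset_with_card_n)
  then obtain C D E where CDE: "T = {C, D, E}" "C \<noteq> D" "C \<noteq> E" "D \<noteq> E"
    by (metis card_3_iff)
  have mem: "C \<in> S" "D \<in> S" "E \<in> S" and out: "C \<notin> {A, B}" "D \<notin> {A, B}" "E \<notin> {A, B}"
    using T CDE by auto
  define c where "c u i = \<lfloor>(u :: real^2) $ i\<rfloor>" for u i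
  have c: "real_of_int (c u i) = u $ i" if "u \<in> S" for u i
    using coord[OF that] by (simp add: c_def)
  have dist_c: "\<exists>d\<ge>0. (c u 1 - c v 1)\<^sup>2 + (c u 2 - c v 2)\<^sup>2 = d\<^sup>2 \<and> dist u v = of_int d"
    if uv: "u \<in> S" "v \<in> S" for u v
  proof -
    obtain d where d: "dist u v = of_int d" using int_dist[OF uv] by (elim Ints_cases)
    have "(dist u v)\<^sup>2 = (u $ 1 - v $ 1)\<^sup>2 + (u $ 2 - v $ 2)\<^sup>2"
      by (simp add: dist_vec_def L2_set_def sum_2 dist_real_def)
    then have "real_of_int (d\<^sup>2) = real_of_int ((c u 1 - c v 1)\<^sup>2 + (c u 2 - c v 2)\<^sup>2)"
      using d c uv by simp
    then have "d\<^sup>2 = (c u 1 - c v 1)\<^sup>2 + (c u 2 - c v 2)\<^sup>2" by (simp only: of_int_eq_iff)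
    moreover have "d \<ge> 0" using d by (metis zero_le_dist of_int_0_le_iff)
    ultimately show ?thesis using d by metis
  qed
  have "(c B 1 - c A 1)\<^sup>2 + (c B 2 - c A 2)\<^sup>2 = 9"
    using dist_c[OF AB(2,1)] AB(3) by (auto simp: dist_commute)
  \<comment> \<open>As 9 is a sum of two integer squares only as 9 + 0, the segment is parallel to
    an axis: \<open>i\<close> is its direction, \<open>j\<close> the coordinate shared by its ends,
    and \<open>e\<close> its orientation.\<close>
  from int_square_sum_9[OF this]
  obtain i j :: 2 where ij: "i = 1 \<and> j = 2 \<or> i = 2 \<and> j = 1"
    and "\<bar>c B i - c A i\<bar> = 3" and Bj: "c B j = c A j"
    by auto
  then obtain e :: int where e: "e = 1 \<or> e = -1" and Bi: "c B i - c A i = 3 * e"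
    by (cases "c B i - c A i \<ge> 0") auto
  \<comment> \<open>Translation, a possible swap of the axes and a possible reflection move
    \<open>A\<close> to (0,0) and \<open>B\<close> to (3,0) and preserve distances.\<close>
  define x where "x u = e * (c u i - c A i)" for u
  define y where "y u = c u j - c A j" for u
  have e2: "e * e = 1" "e\<^sup>2 = 1" using e by auto
  have xy: "\<exists>d\<ge>0. (x u - x v)\<^sup>2 + (y u - y v)\<^sup>2 = d\<^sup>2" if uv: "u \<in> S" "v \<in> S" for u v
  proof -
    have "(x u - x v)\<^sup>2 = (c u i - c v i)\<^sup>2"
      unfolding x_def right_diff_distrib[symmetric] power_mult_distrib e2 by simp
    then have "(x u - x v)\<^sup>2 + (y u - y v)\<^sup>2 = (c u 1 - c v 1)\<^sup>2 + (c u 2 - c v 2)\<^sup>2"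
      using ij by (auto simp: y_def)
    then show ?thesis using dist_c[OF uv] by auto
  qed
  have A0: "x A = 0" "y A = 0" and B3: "x B = 3" "y B = 0"
    using Bi Bj e by (auto simp: x_def y_def)
  \<comment> \<open>A third point on the line through \<open>A\<close> and \<open>B\<close> would
    violate \<open>no_three_collinear\<close>.\<close>
  have y_nz: "y u \<noteq> 0" if u: "u \<in> S" "u \<notin> {A, B}" for u
  proof
    assume "y u = 0"
    then have "u $ j = A $ j" "B $ j = A $ j"
      using c[OF u(1), of j] c[OF AB(1), of j] c[OF AB(2), of j] Bj by (auto simp: y_def)
    then have "collinear {A, B, u}" by (intro collinear_same_coordinate[of _ j]) auto
    moreover have "A \<noteq> B" "A \<noteq> u" "B \<noteq> u" using u \<open>A \<noteq> B\<close> by auto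
    ultimately show False using col u(1) AB(1,2) unfolding no_three_collinear_def by metis
  qed
  have hyp: "(y u)\<^sup>2 = 8 * (x u - 1) * (x u - 2)" if u: "u \<in> S" "u \<notin> {A, B}" for u
  proof -
    obtain p where p: "p \<ge> 0" "(x u)\<^sup>2 + (y u)\<^sup>2 = p\<^sup>2"
      using xy[OF u(1) AB(1)] unfolding A0 by auto
    obtain q where q: "q \<ge> 0" "(x u - 3)\<^sup>2 + (y u)\<^sup>2 = q\<^sup>2"
      using xy[OF u(1) AB(2)] unfolding B3 by auto
    show ?thesis using on_hyperbola[OF p(2) q(2) y_nz[OF u] p(1) q(1)] .
  qed
  have inj: "(x u, y u) \<noteq> (x v, y v)" if "u \<in> S" "v \<in> S" "u \<noteq> v" for u v
  proof
    assume "(x u, y u) = (x v, y v)"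
    then have "c u i = c v i" "c u j = c v j" using e by (auto simp: x_def y_def)
    then have "u $ i = v $ i" "u $ j = v $ j" using c that by metis+
    then have "u = v" using ij by (auto simp: vec_eq_iff forall_2)
    then show False using that by simp
  qed
  obtain d12 d13 d23 where d: "(x C - x D)\<^sup>2 + (y C - y D)\<^sup>2 = d12\<^sup>2"
    "(x C - x E)\<^sup>2 + (y C - y E)\<^sup>2 = d13\<^sup>2" "(x D - x E)\<^sup>2 + (y D - y E)\<^sup>2 = d23\<^sup>2"
    using xy[OF mem(1,2)] xy[OF mem(1,3)] xy[OF mem(2,3)] by blast
  show False
    by (rule no_hyperbola_triple[OF hyp[OF mem(1) out(1)] hyp[OF mem(2) out(2)] hyp[OF mem(3) out(3)]
          y_nz[OF mem(1) out(1)] y_nz[OF mem(2) out(2)] y_nz[OF mem(3) out(3)]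
          inj[OF mem(1,2) CDE(2)] inj[OF mem(1,3) CDE(3)] inj[OF mem(2,3) CDE(4)] d])
qed

theorem mainTheorem3:
  fixes n :: nat and P :: "(real^2) list"
  assumes "n \<ge> 3"
    and "length P = n"
    and "bidiophantine P"
    and "\<exists>u v. (is_side P u v \<or> is_diagonal P u v) \<and> dist u v = 3"
  shows "n \<in> {3, 4}"
proof -
  have P: "distinct P" "no_three_collinear (set P)"
    "\<forall>u \<in> set P. \<forall>v \<in> set P. u \<noteq> v \<longrightarrow> (\<exists>k::nat. k \<ge> 1 \<and> dist u v = real k)"
    "\<forall>u \<in> set P. u $ 1 \<in> \<int> \<and> u $ 2 \<in> \<int>"
    using assms(3) by (auto simp: bidiophantine_def diophantine_def polygon_def)
  obtain A B where AB: "is_side P A B \<or> is_diagonal P A B" "dist A B = 3" using assms(4) by blast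
  have "poly_next P i < length P" for i using assms(1,2) by (simp add: poly_next_def)
  then have mem: "A \<in> set P" "B \<in> set P" using AB(1) by (auto simp: is_side_def is_diagonal_def)
  have "card (set P) \<le> 4"
  proof (rule integral_distance_3_card_le_4[OF _ P(2) _ _ mem AB(2)])
    show "dist u v \<in> \<int>" if "u \<in> set P" "v \<in> set P" for u v
      using P(3) that by (cases "u = v") (auto, metis Ints_of_nat)
    show "u $ i \<in> \<int>" if "u \<in> set P" for u i
      using P(4) that exhaust_2[of i] by auto
  qed simp
  then show ?thesis using assms(1,2) distinct_card[OF P(1)] by auto
qed

end
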